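(* Let $n\ge 1$, let $\Phi=\{f_1,\ldots,f_k\}$ be a finite subset of the free MV-algebra $\mathbf{F}_n$ and let $\beta:\Phi\to[0,1]\cap\mathbb{Q}$ be a rational-valued book on $\Phi$. Let $\Pi_\Phi$, $\Pi_{(\mathrm{rb}\,\Phi)}$ and $\Pi_\beta$ be the formulas of $Ł(k)$ computed by the procedure $\Pi$, axiomatizing respectively the theories $\Theta_{\mathscr{C}_\Phi}$, $\Theta_{(\mathrm{rb}\,\mathscr{C}_\Phi)}$ and $\Theta_{\beta}$. Then the following conditions hold: (1) $\beta$ is coherent if and only if there exists a non-zero $m\in\mathbb{N}$ such that $\vdash(\Pi_\beta)^m\to\Pi_\Phi$. (2) $\beta$ is strictly coherent if and only if there exists a non-zero $m\in\mathbb{N}$ such that $\vdash(\Pi_\beta)^m\to\Pi_\Phi$ and, for all non-zero $m\in\mathbb{N}$, $\not\vdash(\Pi_\beta)^m\to\Pi_{(\mathrm{rb}\,\Phi)}$.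
   Context: $\mathbf{F}_n$ is the free $n$-generated MV-algebra, identified with the algebra of all $n$-variable McNaughton functions: continuous functions $f:[0,1]^n\to[0,1]$ that are piecewise linear (affine) with finitely many pieces, each with integer coefficients, under pointwise operations. Books. A book on $\Phi=\{f_1,\ldots,f_k\}$ is a map $\beta:\Phi\to[0,1]$, identified with the point $\langle\beta(f_1),\ldots,\beta(f_k)\rangle\in[0,1]^k$. It is coherent if there are no $\sigma_1,\ldots,\sigma_k\in\mathbb{R}$ with $\sum_i\sigma_i(\beta(f_i)-f_i(x))<0$ for every $x\in[0,1]^n$. It is strictly coherent if for all $\sigma_1,\ldots,\sigma_k\in\mathbb{R}$, the existence of $x\in[0,1]^n$ with $\sum_i\sigma_i(\beta(f_i)-f_i(x))<0$ implies the existence of $x'\in[0,1]^n$ with $\sum_i\sigma_i(\beta(f_i)-f_i(x'))>0$. Geometry. $\mathscr{C}_\Phi$ is the closure of the convex hull of $\{\langle f_1(x),\ldots,f_k(x)\rangle\mid x\in[0,1]^n\}$ in $\mathbb{R}^k$; it is a polytope with rational vertices. $\mathrm{rb}\,\mathscr{C}_\Phi$ is its relative boundary (a finite union of rational polytopes, possibly empty). Logic. $Ł(k)$ is the set of formulas of propositional Łukasiewicz logic in $k$ variables, with primitive connectives $\neg,\to$ and defined connectives $\varphi\oplus\psi=\neg\varphi\to\psi$, $\varphi\odot\psi=\neg(\neg\varphi\oplus\neg\psi)$, $\varphi\vee\psi=(\varphi\to\psi)\to\psi$. Axioms: $\varphi\to(\psi\to\varphi)$; $(\varphi\to\psi)\to((\psi\to\chi)\to(\varphi\to\chi))$;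 $((\varphi\to\psi)\to\psi)\to((\psi\to\varphi)\to\varphi)$; $(\neg\varphi\to\neg\psi)\to(\psi\to\varphi)$; the only rule is modus ponens. $\vdash\varphi$ means $\varphi$ is derivable. $\psi^m$ denotes $\psi\odot\cdots\odot\psi$ ($m$ times). Each $\psi\in Ł(k)$ determines the McNaughton function $f_\psi:[0,1]^k\to[0,1]$ obtained by interpreting $\neg x=1-x$, $x\to y=\min\{1,1-x+y\}$. A theory is a deductively closed set of formulas; a formula $\theta$ axiomatizes a theory $\Theta$ of $Ł(k)$ if $\Theta$ is the smallest theory of $Ł(k)$ containing $\theta$. For a rational polyhedron $\mathscr{P}\subseteq[0,1]^k$ (a finite union, possibly empty, of convex hulls of finitely many rational points), $\Theta_{\mathscr{P}}=\{\psi\in Ł(k)\mid f_\psi(x)=1\text{ for all }x\in\mathscr{P}\}$; and $\Theta_\beta=\Theta_{\{\beta\}}$. Procedure. $\Pi$ is a fixed effective procedure which, for each finite $\Phi=\{f_1,\ldots,f_k\}\subseteq\mathbf{F}_n$ and each rational $\beta\in[0,1]^k$, computes formulas $\Pi_\Phi,\Pi_{(\mathrm{rb}\,\Phi)},\Pi_\beta\in Ł(k)$ axiomatizing $\Theta_{\mathscr{C}_\Phi}$, $\Theta_{(\mathrm{rb}\,\mathscr{C}_\Phi)}$ and $\Theta_\beta$ respectively. *)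

theory Defs
  imports "HOL-Analysis.Analysis"
begin

section \<open>McNaughton functions\<close>

definition unit_cube :: "(real ^ 'n) set" where
  "unit_cube = {x. \<forall>i. 0 \<le> x $ i \<and> x $ i \<le> 1}"

text \<open>
  The free MV-algebra over \<open>CARD('n)\<close> generators.  Its elements are functions on the unit cube only;
  requiring extensionality (the value is \<open>undefined\<close> outside the cube) makes HOL equality coincide
  with equality of functions on the cube.  A pair \<open>(a, b)\<close> stands for the affine function
  \<open>x \<mapsto> a \<bullet> x + b\<close>.
\<close>

definition McNaughton :: "(real ^ 'n \<Rightarrow> real) set" where
  "McNaughton = {f \<in> unit_cube \<rightarrow>\<^sub>E {0..1}. continuous_on unit_cube f \<and>
     (\<exists>P :: ((int ^ 'n) \<times> int) set. finite P \<and>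
        (\<forall>x\<in>unit_cube. \<exists>(a, b)\<in>P. f x = (\<Sum>i\<in>UNIV. of_int (a $ i) * x $ i) + of_int b))}"


section \<open>Books\<close>

definition coherent :: "(real ^ 'n \<Rightarrow> real) set \<Rightarrow> ((real ^ 'n \<Rightarrow> real) \<Rightarrow> real) \<Rightarrow> bool" where
  "coherent \<Phi> \<beta> \<longleftrightarrow>
     \<not> (\<exists>\<sigma> :: (real ^ 'n \<Rightarrow> real) \<Rightarrow> real. \<forall>x\<in>unit_cube. (\<Sum>f\<in>\<Phi>. \<sigma> f * (\<beta> f - f x)) < 0)"

definition strictly_coherent ::
  "(real ^ 'n \<Rightarrow> real) set \<Rightarrow> ((real ^ 'n \<Rightarrow> real) \<Rightarrow> real) \<Rightarrow> bool" where
  "strictly_coherent \<Phi> \<beta> \<longleftrightarrow>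
     (\<forall>\<sigma> :: (real ^ 'n \<Rightarrow> real) \<Rightarrow> real.
        (\<exists>x\<in>unit_cube. (\<Sum>f\<in>\<Phi>. \<sigma> f * (\<beta> f - f x)) < 0) \<longrightarrow>
        (\<exists>x'\<in>unit_cube. (\<Sum>f\<in>\<Phi>. \<sigma> f * (\<beta> f - f x')) > 0))"

text \<open>The polytope depends on the enumeration \<open>f\<close> of the set of events, which fixes the coordinates.\<close>

definition events_polytope :: "('k \<Rightarrow> real ^ 'n \<Rightarrow> real) \<Rightarrow> (real ^ 'k) set" where
  "events_polytope f = closure (convex hull ((\<lambda>x. \<chi> i. f i x) ` unit_cube))"


section \<open>Propositional Lukasiewicz logic\<close>

datatype 'k luk =
    Var 'k
  | Neg "'k luk"
  | Imp "'k luk" "'k luk"  (infixr "\<^bold>\<longrightarrow>" 25)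

definition Oplus :: "'k luk \<Rightarrow> 'k luk \<Rightarrow> 'k luk"  (infixl "\<^bold>\<oplus>" 65) where
  "\<phi> \<^bold>\<oplus> \<psi> = (Neg \<phi> \<^bold>\<longrightarrow> \<psi>)"

definition Odot :: "'k luk \<Rightarrow> 'k luk \<Rightarrow> 'k luk"  (infixl "\<^bold>\<odot>" 70) where
  "\<phi> \<^bold>\<odot> \<psi> = Neg (Neg \<phi> \<^bold>\<oplus> Neg \<psi>)"

text \<open>
  The language has no truth constant; \<open>\<psi>\<close> to the power \<open>0\<close> is set to the tautology \<open>\<psi> \<^bold>\<longrightarrow> \<psi>\<close>.
\<close>

fun luk_pow :: "'k luk \<Rightarrow> nat \<Rightarrow> 'k luk" where
  "luk_pow \<psi> 0 = (\<psi> \<^bold>\<longrightarrow> \<psi>)"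
| "luk_pow \<psi> (Suc 0) = \<psi>"
| "luk_pow \<psi> (Suc (Suc m)) = luk_pow \<psi> (Suc m) \<^bold>\<odot> \<psi>"

inductive derives :: "'k luk set \<Rightarrow> 'k luk \<Rightarrow> bool"  (infix "\<turnstile>" 20) for \<Gamma> where
  hyp: "\<phi> \<in> \<Gamma> \<Longrightarrow> \<Gamma> \<turnstile> \<phi>"
| ax1: "\<Gamma> \<turnstile> \<phi> \<^bold>\<longrightarrow> (\<psi> \<^bold>\<longrightarrow> \<phi>)"
| ax2: "\<Gamma> \<turnstile> (\<phi> \<^bold>\<longrightarrow> \<psi>) \<^bold>\<longrightarrow> ((\<psi> \<^bold>\<longrightarrow> \<xi>) \<^bold>\<longrightarrow> (\<phi> \<^bold>\<longrightarrow> \<xi>))"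
| ax3: "\<Gamma> \<turnstile> ((\<phi> \<^bold>\<longrightarrow> \<psi>) \<^bold>\<longrightarrow> \<psi>) \<^bold>\<longrightarrow> ((\<psi> \<^bold>\<longrightarrow> \<phi>) \<^bold>\<longrightarrow> \<phi>)"
| ax4: "\<Gamma> \<turnstile> (Neg \<phi> \<^bold>\<longrightarrow> Neg \<psi>) \<^bold>\<longrightarrow> (\<psi> \<^bold>\<longrightarrow> \<phi>)"
| mp: "\<Gamma> \<turnstile> \<phi> \<^bold>\<longrightarrow> \<psi> \<Longrightarrow> \<Gamma> \<turnstile> \<phi> \<Longrightarrow> \<Gamma> \<turnstile> \<psi>"

definition luk_theory :: "'k luk set \<Rightarrow> bool" where
  "luk_theory \<Theta> \<longleftrightarrow> (\<forall>\<phi>. (\<Theta> \<turnstile> \<phi>) \<longrightarrow> \<phi> \<in> \<Theta>)"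

definition axiomatizes :: "'k luk \<Rightarrow> 'k luk set \<Rightarrow> bool" where
  "axiomatizes \<theta> \<Theta> \<longleftrightarrow> luk_theory \<Theta> \<and> \<theta> \<in> \<Theta> \<and>
     (\<forall>\<Theta>'. luk_theory \<Theta>' \<and> \<theta> \<in> \<Theta>' \<longrightarrow> \<Theta> \<subseteq> \<Theta>')"

primrec luk_eval :: "'k luk \<Rightarrow> real ^ 'k \<Rightarrow> real" where
  "luk_eval (Var i) x = x $ i"
| "luk_eval (Neg \<phi>) x = 1 - luk_eval \<phi> x"
| "luk_eval (\<phi> \<^bold>\<longrightarrow> \<psi>) x = min 1 (1 - luk_eval \<phi> x + luk_eval \<psi> x)"

text \<open>The theory of a set of valuations, intended for subsets of the unit cube.\<close>

definition Th :: "(real ^ 'k) set \<Rightarrow> 'k luk set" where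
  "Th P = {\<psi>. \<forall>x\<in>P. luk_eval \<psi> x = 1}"

end

(*
  Two independent facts meet.  Logically, the local deduction theorem says that some power of
  Pi_beta implies a formula iff that formula is derivable from Pi_beta, i.e. evaluates to 1 at the
  point beta; and for closed K in the cube and beta outside K there is a formula with value 1 on K
  and 0 at beta (a sum of one-variable piecewise linear bumps with integer coefficients), so an
  axiom of Th K has value 1 at beta iff beta lies in K.  Geometrically, by the separating and supporting
  hyperplane theorems, beta is coherent iff it lies in the polytope and strictly coherent iff it
  lies in its relative interior, i.e. in the polytope but off the relative boundary.
*)

theory Submission
  imports Defs
begin

section \<open>The local deduction theorem\<close>

lemma derives_trans: "\<Gamma> \<turnstile> \<phi> \<^bold>\<longrightarrow> \<psi> \<Longrightarrow> \<Gamma> \<turnstile> \<psi> \<^bold>\<longrightarrow> \<xi> \<Longrightarrow> \<Gamma> \<turnstile> \<phi> \<^bold>\<longrightarrow> \<xi>"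
  by (meson ax2 mp)

lemma derives_weaken: "\<Gamma> \<turnstile> \<psi> \<Longrightarrow> \<Gamma> \<turnstile> \<phi> \<^bold>\<longrightarrow> \<psi>"
  by (meson ax1 mp)

text \<open>Axiom \<open>ax1\<close> gives \<phi> \<longrightarrow> ((\<psi> \<longrightarrow>
  \<phi>) \<longrightarrow> \<phi>), and \<open>ax3\<close>, the commutativity of disjunction, swaps
  the two formulas.\<close>

lemma derives_assertion: "\<Gamma> \<turnstile> \<phi> \<^bold>\<longrightarrow> ((\<phi> \<^bold>\<longrightarrow> \<psi>) \<^bold>\<longrightarrow> \<psi>)"
  by (rule derives_trans [OF ax1 ax3])

lemma derives_exchange: "\<Gamma> \<turnstile> (\<phi> \<^bold>\<longrightarrow> (\<psi> \<^bold>\<longrightarrow> \<xi>)) \<^bold>\<longrightarrow> (\<psi> \<^bold>\<longrightarrow> (\<phi> \<^bold>\<longrightarrow> \<xi>))"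
  by (rule derives_trans [OF ax2 mp [OF ax2 derives_assertion]])

lemma derives_refl: "\<Gamma> \<turnstile> \<phi> \<^bold>\<longrightarrow> \<phi>"
  by (rule mp [OF mp [OF derives_exchange ax1] ax1])

lemma derives_prefix: "\<Gamma> \<turnstile> (\<psi> \<^bold>\<longrightarrow> \<xi>) \<^bold>\<longrightarrow> ((\<phi> \<^bold>\<longrightarrow> \<psi>) \<^bold>\<longrightarrow> (\<phi> \<^bold>\<longrightarrow> \<xi>))"
  by (rule mp [OF derives_exchange ax2])

lemma derives_double_neg_elim: "\<Gamma> \<turnstile> Neg (Neg \<phi>) \<^bold>\<longrightarrow> \<phi>"
proof -
  have "\<Gamma> \<turnstile> Neg (Neg \<phi>) \<^bold>\<longrightarrow> ((\<phi> \<^bold>\<longrightarrow> \<phi>) \<^bold>\<longrightarrow> \<phi>)"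
    \<comment> \<open>\<open>ax1\<close> is taken with the double negation of \<phi>
      \<longrightarrow> \<phi> as premise, so that \<open>ax4\<close> applies twice and leaves a
      provable premise.\<close>
    by (rule derives_trans [OF ax1 derives_trans [OF ax4 ax4]])
  then show ?thesis
    by (rule mp [OF mp [OF derives_exchange] derives_refl])
qed

lemma derives_double_neg_intro: "\<Gamma> \<turnstile> \<phi> \<^bold>\<longrightarrow> Neg (Neg \<phi>)"
  by (rule mp [OF ax4 derives_double_neg_elim])

lemma derives_contrapos: "\<Gamma> \<turnstile> (\<phi> \<^bold>\<longrightarrow> \<psi>) \<^bold>\<longrightarrow> (Neg \<psi> \<^bold>\<longrightarrow> Neg \<phi>)"
  by (rule derives_trans [OF mp [OF ax2 derives_double_neg_elim]
        derives_trans [OF mp [OF derives_prefix derives_double_neg_intro] ax4]])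

text \<open>Unfolded, the strong conjunction is a negated implication, so the contrapositive is
  derived: the negation of \<xi> yields that implication.\<close>

lemma derives_residuation:
  assumes "\<Gamma> \<turnstile> \<phi> \<^bold>\<longrightarrow> (\<psi> \<^bold>\<longrightarrow> \<xi>)"
  shows "\<Gamma> \<turnstile> (\<phi> \<^bold>\<odot> \<psi>) \<^bold>\<longrightarrow> \<xi>"
proof -
  have "\<Gamma> \<turnstile> Neg \<xi> \<^bold>\<longrightarrow> (\<phi> \<^bold>\<longrightarrow> Neg \<psi>)"
    by (rule mp [OF derives_exchange derives_trans [OF assms derives_contrapos]])
  then have "\<Gamma> \<turnstile> Neg \<xi> \<^bold>\<longrightarrow> (Neg (Neg \<phi>) \<^bold>\<longrightarrow> Neg \<psi>)"
    by (rule derives_trans [OF _ mp [OF ax2 derives_double_neg_elim]])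
  then show ?thesis
    unfolding Odot_def Oplus_def
    by (rule mp [OF ax4 derives_trans [OF _ derives_double_neg_intro]])
qed

section \<open>Iterated implications and powers\<close>

lemma derives_iterated_mono:
  assumes "\<Gamma> \<turnstile> \<phi> \<^bold>\<longrightarrow> \<psi>"
  shows "\<Gamma> \<turnstile> (Imp \<theta> ^^ m) \<phi> \<^bold>\<longrightarrow> (Imp \<theta> ^^ m) \<psi>"
  by (induction m) (use assms in \<open>auto intro: mp [OF derives_prefix]\<close>)

lemma derives_iterated_exchange:
  "\<Gamma> \<turnstile> (Imp \<theta> ^^ m) (\<phi> \<^bold>\<longrightarrow> \<psi>) \<^bold>\<longrightarrow> (\<phi> \<^bold>\<longrightarrow> (Imp \<theta> ^^ m) \<psi>)"
proof (induction m)
  case 0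
  show ?case by (simp add: derives_refl)
next
  case (Suc m)
  then show ?case
    by (auto intro: derives_trans [OF mp [OF derives_prefix Suc] derives_exchange])
qed

text \<open>\<open>luk_pow\<close> multiplies on the right, so the innermost premise is split off:
  the induction hypothesis is used at \<theta> \<longrightarrow> \<psi>, and residuation absorbs the
  last \<theta> into the power.\<close>

lemma derives_luk_pow_if_iterated:
  assumes "\<Gamma> \<turnstile> (Imp \<theta> ^^ Suc m) \<psi>"
  shows "\<Gamma> \<turnstile> luk_pow \<theta> (Suc m) \<^bold>\<longrightarrow> \<psi>"
  using assms
proof (induction m arbitrary: \<psi>)
  case 0
  then show ?case by simp
next
  case (Suc m)
  from Suc.prems have "\<Gamma> \<turnstile> (Imp \<theta> ^^ Suc m) (\<theta> \<^bold>\<longrightarrow> \<psi>)"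
    by (simp add: funpow_swap1)
  then show ?case
    by (simp add: Suc.IH derives_residuation)
qed

text \<open>In the absence of contraction every use of \<theta> is counted. The iterated implication
  records the count: 0 for axioms and members of \<Gamma>, 1 for \<theta>, and the sum of both
  counts at modus ponens.\<close>

theorem local_deduction:
  assumes "insert \<theta> \<Gamma> \<turnstile> \<psi>"
  shows "\<exists>m. m \<noteq> 0 \<and> (\<Gamma> \<turnstile> luk_pow \<theta> m \<^bold>\<longrightarrow> \<psi>)"
proof -
  have iterated: "\<exists>m. \<Gamma> \<turnstile> (Imp \<theta> ^^ m) \<psi>"
    using assms
  proof induction
    case (hyp \<phi>)
    have "\<Gamma> \<turnstile> (Imp \<theta> ^^ 1) \<phi>" if "\<phi> = \<theta>"
      using that by (simp add: derives_refl)
    moreover have "\<Gamma> \<turnstile> (Imp \<theta> ^^ 0) \<phi>" if "\<phi> \<in> \<Gamma>"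
      using that by (simp add: derives.hyp)
    ultimately show ?case using hyp by blast
  next
    case (mp \<phi> \<psi>)
    then obtain m n where m: "\<Gamma> \<turnstile> (Imp \<theta> ^^ m) (\<phi> \<^bold>\<longrightarrow> \<psi>)" and n: "\<Gamma> \<turnstile> (Imp \<theta> ^^ n) \<phi>"
      by blast
    have "\<Gamma> \<turnstile> \<phi> \<^bold>\<longrightarrow> (Imp \<theta> ^^ m) \<psi>"
      by (rule derives.mp [OF derives_iterated_exchange m])
    then have "\<Gamma> \<turnstile> (Imp \<theta> ^^ n) ((Imp \<theta> ^^ m) \<psi>)"
      by (rule derives.mp [OF derives_iterated_mono n])
    then show ?case
      by (metis funpow_add comp_apply)
  qed (metis funpow_0 ax1 ax2 ax3 ax4)+
  then obtain m where "\<Gamma> \<turnstile> (Imp \<theta> ^^ m) \<psi>" ..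
  then have "\<Gamma> \<turnstile> (Imp \<theta> ^^ Suc m) \<psi>"
    by (simp add: derives_weaken)
  then show ?thesis
    using derives_luk_pow_if_iterated by blast
qed

section \<open>Axiomatized theories as deductive closures\<close>

lemma derives_cut: "\<Gamma> \<turnstile> \<phi> \<Longrightarrow> (\<And>\<psi>. \<psi> \<in> \<Gamma> \<Longrightarrow> \<Delta> \<turnstile> \<psi>) \<Longrightarrow> \<Delta> \<turnstile> \<phi>"
  by (induction rule: derives.induct) (auto intro: derives.intros)

text \<open>By cut, the consequences of \<theta> form a theory containing \<theta>. Leastness of
  \<Theta> gives one inclusion, its deductive closure the other.\<close>

lemma axiomatizes_derives_iff:
  assumes "axiomatizes \<theta> \<Theta>"
  shows "({\<theta>} \<turnstile> \<psi>) \<longleftrightarrow> \<psi> \<in> \<Theta>"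
proof
  assume "{\<theta>} \<turnstile> \<psi>"
  then have "\<Theta> \<turnstile> \<psi>"
    using assms by (auto simp: axiomatizes_def intro: derives_cut derives.hyp)
  then show "\<psi> \<in> \<Theta>"
    using assms by (simp add: axiomatizes_def luk_theory_def)
next
  have "luk_theory {\<psi>. {\<theta>} \<turnstile> \<psi>}" "\<theta> \<in> {\<psi>. {\<theta>} \<turnstile> \<psi>}"
    by (auto simp: luk_theory_def intro: derives_cut derives.hyp)
  then have "\<Theta> \<subseteq> {\<psi>. {\<theta>} \<turnstile> \<psi>}"
    using assms unfolding axiomatizes_def by blast
  then show "{\<theta>} \<turnstile> \<psi>" if "\<psi> \<in> \<Theta>"
    using that by blast
qed


section \<open>Soundness and separating formulas\<close>

lemma luk_eval_bounds:
  assumes "x \<in> unit_cube"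
  shows "0 \<le> luk_eval \<phi> x" "luk_eval \<phi> x \<le> 1"
  by (induction \<phi>) (use assms in \<open>auto simp: unit_cube_def\<close>)

lemma soundness:
  assumes "\<Gamma> \<turnstile> \<phi>" "x \<in> unit_cube" "\<And>\<psi>. \<psi> \<in> \<Gamma> \<Longrightarrow> luk_eval \<psi> x = 1"
  shows "luk_eval \<phi> x = 1"
  using assms(1)
proof induction
  case (ax1 \<phi> \<psi>)
  show ?case
    using luk_eval_bounds [OF assms(2), of \<phi>] luk_eval_bounds [OF assms(2), of \<psi>] by auto
next
  case (ax2 \<phi> \<psi> \<xi>)
  show ?case
    using luk_eval_bounds [OF assms(2), of \<phi>] luk_eval_bounds [OF assms(2), of \<psi>]
      luk_eval_bounds [OF assms(2), of \<xi>] by auto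
next
  case (ax3 \<phi> \<psi>)
  show ?case
    using luk_eval_bounds [OF assms(2), of \<phi>] luk_eval_bounds [OF assms(2), of \<psi>] by auto
next
  case (mp \<phi> \<psi>)
  then show ?case
    using luk_eval_bounds(2) [OF assms(2), of \<psi>] by simp
qed (use assms in auto)

section \<open>Formulas as piecewise linear functions\<close>

lemma luk_eval_pow_eq_1:
  "luk_eval \<phi> x = 1 \<Longrightarrow> luk_eval (luk_pow \<phi> m) x = 1"
  by (induction \<phi> m rule: luk_pow.induct) (auto simp: Odot_def Oplus_def)

lemma luk_eval_Oplus: "luk_eval (\<phi> \<^bold>\<oplus> \<psi>) x = min 1 (luk_eval \<phi> x + luk_eval \<psi> x)"
  by (simp add: Oplus_def)

lemma luk_eval_Odot: "luk_eval (\<phi> \<^bold>\<odot> \<psi>) x = max 0 (luk_eval \<phi> x + luk_eval \<psi> x - 1)"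
  by (simp add: Odot_def Oplus_def)

text \<open>These ramps are the building blocks of the bumps. The induction on the slope uses the
  offsets M and M - 1, so M ranges over all integers.\<close>

lemma ex_luk_truncated_affine:
  "\<exists>\<phi>. \<forall>x\<in>unit_cube. luk_eval \<phi> x = max 0 (min 1 (of_nat N * x $ i - of_int M))"
proof (induction N arbitrary: M)
  case 0
  show ?case
  \<comment> \<open>At slope 0 the function is constantly 1 or 0; a tautology and its negation stand
    in for the truth constants.\<close>
  proof (cases "M < 0")
    case True
    then have "(1::real) \<le> - of_int M" by linarith
    then show ?thesis
      by (intro exI [of _ "Var i \<^bold>\<longrightarrow> Var i"]) auto
  next
    case False
    then show ?thesis
      by (intro exI [of _ "Neg (Var i \<^bold>\<longrightarrow> Var i)"]) auto
  qed
next
  case (Suc N)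
  obtain \<phi> where \<phi>: "\<forall>x\<in>unit_cube. luk_eval \<phi> x = max 0 (min 1 (of_nat N * x $ i - of_int M))"
    using Suc by blast
  obtain \<psi> where \<psi>: "\<forall>x\<in>unit_cube. luk_eval \<psi> x = max 0 (min 1 (of_nat N * x $ i - of_int (M - 1)))"
    using Suc by blast
  \<comment> \<open>For \<open>t \<in> [0,1]\<close>, truncating \<open>h + t\<close> to \<open>[0,1]\<close> gives \<open>(h \<oplus> t) \<odot> (h + 1)\<close> with \<open>h\<close> and \<open>h + 1\<close> truncated.\<close>
  have "luk_eval ((\<phi> \<^bold>\<oplus> Var i) \<^bold>\<odot> \<psi>) x = max 0 (min 1 (of_nat (Suc N) * x $ i - of_int M))"
    if "x \<in> unit_cube" for x
  proof -
    have "0 \<le> x $ i" "x $ i \<le> 1"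
      using that by (auto simp: unit_cube_def)
    define h where "h = of_nat N * x $ i - of_int M"
    have eval: "luk_eval \<phi> x = max 0 (min 1 h)" "luk_eval \<psi> x = max 0 (min 1 (h + 1))"
      using \<phi> \<psi> that by (auto simp: h_def)
    have step: "of_nat (Suc N) * x $ i - of_int M = h + x $ i"
      by (simp add: h_def algebra_simps)
    show ?thesis
      unfolding luk_eval_Oplus luk_eval_Odot luk_eval.simps eval step
      using \<open>0 \<le> x $ i\<close> \<open>x $ i \<le> 1\<close> by linarith
  qed
  then show ?case by blast
qed

text \<open>Two ramps of slope N suffice: \<phi> starts to rise at or just right of b, \<psi> has
  already reached 1 there, and the sum of \<phi> and the negation of \<psi> vanishes at b.\<close>

lemma ex_luk_bump:
  assumes "\<epsilon> > 0" "b \<in> unit_cube"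
  shows "\<exists>\<phi>. luk_eval \<phi> b = 0 \<and> (\<forall>x\<in>unit_cube. \<bar>x $ i - b $ i\<bar> \<ge> \<epsilon> \<longrightarrow> luk_eval \<phi> x = 1)"
proof -
  obtain N :: nat where "2 / \<epsilon> < of_nat N"
    using reals_Archimedean2 by blast
  \<comment> \<open>One unit pays for rounding N times the coordinate of b to an integer, the other
    for the ramp itself.\<close>
  then have N: "2 \<le> of_nat N * \<epsilon>"
    using assms(1) by (simp add: field_simps)
  define t where "t = of_nat N * b $ i"
  obtain \<phi> where \<phi>: "\<forall>x\<in>unit_cube. luk_eval \<phi> x = max 0 (min 1 (of_nat N * x $ i - of_int \<lceil>t\<rceil>))"
    using ex_luk_truncated_affine by blast
  obtain \<psi> where \<psi>: "\<forall>x\<in>unit_cube. luk_eval \<psi> x = max 0 (min 1 (of_nat N * x $ i - of_int (\<lfloor>t\<rfloor> - 1)))"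
    using ex_luk_truncated_affine by blast
  have "luk_eval \<phi> b = 0" "luk_eval \<psi> b = 1"
    using assms(2) \<phi> \<psi> t_def by (auto simp: max_def min_def; linarith)+
  moreover have "luk_eval (\<phi> \<^bold>\<oplus> Neg \<psi>) x = 1"
    if x: "x \<in> unit_cube" and far: "\<bar>x $ i - b $ i\<bar> \<ge> \<epsilon>" for x
  proof -
    consider "x $ i \<ge> b $ i + \<epsilon>" | "x $ i \<le> b $ i - \<epsilon>"
      using far by linarith
    then show ?thesis
    proof cases
      case 1
      then have "of_nat N * x $ i \<ge> t + of_nat N * \<epsilon>"
        unfolding t_def by (metis distrib_left mult_left_mono of_nat_0_le_iff)
      with N have "of_nat N * x $ i - of_int \<lceil>t\<rceil> \<ge> 1" by linarith
      then have "luk_eval \<phi> x = 1" using \<phi> x by simp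
      then show ?thesis using luk_eval_bounds [OF x, of \<psi>] by (simp add: luk_eval_Oplus)
    next
      case 2
      then have "of_nat N * x $ i \<le> t - of_nat N * \<epsilon>"
        unfolding t_def by (metis right_diff_distrib mult_left_mono of_nat_0_le_iff)
      with N have "of_nat N * x $ i - of_int (\<lfloor>t\<rfloor> - 1) \<le> 0" by linarith
      then have "luk_eval \<psi> x = 0" using \<psi> x by simp
      then show ?thesis using luk_eval_bounds [OF x, of \<phi>] by (simp add: luk_eval_Oplus)
    qed
  qed
  ultimately show ?thesis
    by (intro exI [of _ "\<phi> \<^bold>\<oplus> Neg \<psi>"]) (simp add: luk_eval_Oplus)
qed

text \<open>Every point of K is away from b by at least \<epsilon> in some coordinate, so the
  truncated sum of the bumps over all coordinates is 1 on K and 0 at b.\<close>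

lemma ex_luk_separating:
  fixes b :: "real ^ 'k::finite"
  assumes "closed K" "K \<subseteq> unit_cube" "b \<in> unit_cube" "b \<notin> K"
  shows "\<exists>\<phi>\<in>Th K. luk_eval \<phi> b = 0"
proof -
  obtain e where e: "e > 0" "ball b e \<subseteq> - K"
    using assms(1,4) by (metis ComplI open_Compl open_contains_ball)
  \<comment> \<open>The Euclidean norm is at most the sum of the absolute coordinates; if all of
    these are below \<epsilon>, the norm is below e.\<close>
  define \<epsilon> where "\<epsilon> = e / of_nat CARD('k)"
  have "\<epsilon> > 0"
    using e by (simp add: \<epsilon>_def)
  have far: "\<exists>i. \<bar>x $ i - b $ i\<bar> \<ge> \<epsilon>" if "x \<in> K" for x
  proof (rule ccontr)
    assume "\<not> ?thesis"
    then have "norm (x - b) < of_nat CARD('k) * \<epsilon>"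
      using norm_le_l1_cart [of "x - b"] sum_bounded_above_strict [of UNIV "\<lambda>i. \<bar>(x - b) $ i\<bar>" \<epsilon>]
      by (simp add: not_le)
    then have "x \<in> ball b e"
      by (simp add: \<epsilon>_def dist_norm norm_minus_commute)
    then show False
      using e that by blast
  qed
  have "\<exists>\<phi>. luk_eval \<phi> b = 0 \<and>
      (\<forall>x\<in>unit_cube. (\<exists>i\<in>I. \<bar>x $ i - b $ i\<bar> \<ge> \<epsilon>) \<longrightarrow> luk_eval \<phi> x = 1)" for I :: "'k set"
    using finite [of I]
  proof induction
    case empty
    show ?case
      by (intro exI [of _ "Neg (Var undefined \<^bold>\<longrightarrow> Var undefined)"]) simp
  next
    case (insert i I)
    then obtain \<phi> where \<phi>: "luk_eval \<phi> b = 0"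
      "\<forall>x\<in>unit_cube. (\<exists>i\<in>I. \<bar>x $ i - b $ i\<bar> \<ge> \<epsilon>) \<longrightarrow> luk_eval \<phi> x = 1"
      by blast
    obtain \<psi> where \<psi>: "luk_eval \<psi> b = 0"
      "\<forall>x\<in>unit_cube. \<bar>x $ i - b $ i\<bar> \<ge> \<epsilon> \<longrightarrow> luk_eval \<psi> x = 1"
      using ex_luk_bump [OF \<open>\<epsilon> > 0\<close> assms(3)] by blast
    have "luk_eval (\<phi> \<^bold>\<oplus> \<psi>) x = 1"
      if "x \<in> unit_cube" "\<exists>j\<in>insert i I. \<bar>x $ j - b $ j\<bar> \<ge> \<epsilon>" for x
      using that \<phi>(2) \<psi>(2) luk_eval_bounds [OF that(1), of \<phi>] luk_eval_bounds [OF that(1), of \<psi>]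
      by (auto simp: luk_eval_Oplus)
    then show ?case
      using \<phi>(1) \<psi>(1) by (intro exI [of _ "\<phi> \<^bold>\<oplus> \<psi>"]) (simp add: luk_eval_Oplus)
  qed
  from this [of UNIV] show ?thesis
    using far assms(2) by (fastforce simp: Th_def)
qed

text \<open>If b were outside K, a separating formula would follow from \<theta>, and soundness at b
  would force its value there to be 1 instead of 0.\<close>

lemma luk_eval_axiom_eq_1_iff:
  assumes "axiomatizes \<theta> (Th K)" "closed K" "K \<subseteq> unit_cube" "b \<in> unit_cube"
  shows "luk_eval \<theta> b = 1 \<longleftrightarrow> b \<in> K"
proof
  assume "b \<in> K"
  then show "luk_eval \<theta> b = 1"
    using assms(1) by (simp add: axiomatizes_def Th_def)
next
  assume eval: "luk_eval \<theta> b = 1"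
  show "b \<in> K"
  proof (rule ccontr)
    assume "b \<notin> K"
    then obtain \<phi> where \<phi>: "\<phi> \<in> Th K" "luk_eval \<phi> b = 0"
      using ex_luk_separating assms by blast
    then have "{\<theta>} \<turnstile> \<phi>"
      by (simp add: axiomatizes_derives_iff [OF assms(1)])
    then have "luk_eval \<phi> b = 1"
      by (rule soundness) (use assms eval in auto)
    with \<phi> show False by simp
  qed
qed

text \<open>Forwards, the implication is evaluated at b, where the power has value 1. Backwards,
  \<theta> lies in the theory of b, hence is derivable from \<open>\<theta>\<^sub>b\<close>, and
  local deduction supplies the exponent.\<close>

lemma derives_power_axiom_iff:
  assumes "axiomatizes \<theta> (Th K)" "closed K" "K \<subseteq> unit_cube"
    and "axiomatizes \<theta>\<^sub>b (Th {b})" "b \<in> unit_cube"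
  shows "(\<exists>m. m \<noteq> 0 \<and> ({} \<turnstile> luk_pow \<theta>\<^sub>b m \<^bold>\<longrightarrow> \<theta>)) \<longleftrightarrow> b \<in> K"
proof
  assume "\<exists>m. m \<noteq> 0 \<and> ({} \<turnstile> luk_pow \<theta>\<^sub>b m \<^bold>\<longrightarrow> \<theta>)"
  then obtain m where m: "{} \<turnstile> luk_pow \<theta>\<^sub>b m \<^bold>\<longrightarrow> \<theta>" by blast
  have "luk_eval (luk_pow \<theta>\<^sub>b m) b = 1"
    using assms(4) by (intro luk_eval_pow_eq_1) (simp add: axiomatizes_def Th_def)
  moreover have "luk_eval (luk_pow \<theta>\<^sub>b m \<^bold>\<longrightarrow> \<theta>) b = 1"
    using m assms(5) by (rule soundness) simp
  ultimately have "luk_eval \<theta> b = 1"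
    using luk_eval_bounds [OF assms(5), of \<theta>] by simp
  then show "b \<in> K"
    using luk_eval_axiom_eq_1_iff assms by blast
next
  assume "b \<in> K"
  then have "\<theta> \<in> Th {b}"
    using assms(1) by (simp add: axiomatizes_def Th_def)
  then have "{\<theta>\<^sub>b} \<turnstile> \<theta>"
    by (simp add: axiomatizes_derives_iff [OF assms(4)])
  then show "\<exists>m. m \<noteq> 0 \<and> ({} \<turnstile> luk_pow \<theta>\<^sub>b m \<^bold>\<longrightarrow> \<theta>)"
    by (rule local_deduction)
qed


section \<open>Coherence and convexity\<close>

lemma unit_cube_eq_cbox: "unit_cube = cbox 0 1"
  by (auto simp: unit_cube_def mem_box_cart)

lemma not_all_inner_greater_if_in_hull:
  assumes "b \<in> convex hull S"
  shows "\<exists>y\<in>S. a \<bullet> y \<le> a \<bullet> b"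
proof (rule ccontr)
  assume "\<not> ?thesis"
  then have "convex hull S \<subseteq> {y. a \<bullet> y > a \<bullet> b}"
    by (intro hull_minimal) (auto simp: convex_halfspace_gt)
  then show False using assms by blast
qed

text \<open>A vector of stakes with a sure loss is the normal of a hyperplane strictly separating b
  from S; compactness makes the hull closed, so one exists whenever b is outside.\<close>

lemma in_convex_hull_iff_no_arbitrage:
  fixes S :: "'a::euclidean_space set"
  assumes "compact S"
  shows "b \<in> convex hull S \<longleftrightarrow> \<not> (\<exists>a. \<forall>y\<in>S. a \<bullet> (b - y) < 0)"
proof
  show "b \<in> convex hull S" if no: "\<not> (\<exists>a. \<forall>y\<in>S. a \<bullet> (b - y) < 0)"
  proof (rule ccontr)
    assume "b \<notin> convex hull S"
    moreover have "closed (convex hull S)"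
      using assms by (simp add: compact_convex_hull compact_imp_closed)
    ultimately obtain a c where "a \<bullet> b < c" "\<forall>y\<in>convex hull S. a \<bullet> y > c"
      using separating_hyperplane_closed_point [OF convex_convex_hull] by blast
    then have "a \<bullet> (b - y) < 0" if "y \<in> S" for y
      using hull_inc [OF that, of convex] \<open>a \<bullet> b < c\<close> unfolding inner_diff_right
      by (meson diff_less_0_iff_less less_trans)
    with no show False by blast
  qed
next
  show "\<not> (\<exists>a. \<forall>y\<in>S. a \<bullet> (b - y) < 0)" if "b \<in> convex hull S"
    using not_all_inner_greater_if_in_hull [OF that] by (simp add: inner_diff_right not_less)
qed

text \<open>From a relative interior point, the segment from a losing y can be prolonged beyond b
  within the hull, towards a gain. At a relative boundary point, a supporting hyperplane gives
  stakes with losses but no gain.\<close>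

lemma in_rel_interior_hull_iff:
  fixes S :: "'a::euclidean_space set"
  assumes "compact S" "S \<noteq> {}"
  shows "b \<in> rel_interior (convex hull S) \<longleftrightarrow>
    (\<forall>a. (\<exists>y\<in>S. a \<bullet> (b - y) < 0) \<longrightarrow> (\<exists>y\<in>S. a \<bullet> (b - y) > 0))"
    (is "_ \<longleftrightarrow> ?strict")
proof
  assume b: "b \<in> rel_interior (convex hull S)"
  show ?strict
  proof (intro allI impI)
    fix a assume "\<exists>y\<in>S. a \<bullet> (b - y) < 0"
    then obtain y where y: "y \<in> S" "a \<bullet> (b - y) < 0" by blast
    have "\<forall>x\<in>convex hull S. \<exists>e>1. (1 - e) *\<^sub>R x + e *\<^sub>R b \<in> convex hull S"
      using b assms(2) by (simp add: convex_rel_interior_iff)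
    from bspec [OF this hull_inc [OF y(1)]] obtain e where e: "e > 1" "(1 - e) *\<^sub>R y + e *\<^sub>R b \<in> convex hull S"
      by blast
    have "a \<bullet> ((1 - e) *\<^sub>R y + e *\<^sub>R b) = a \<bullet> b + (e - 1) * (a \<bullet> (b - y))"
      by (simp add: inner_simps algebra_simps)
    moreover have "(e - 1) * (a \<bullet> (b - y)) < 0"
      using e y by (simp add: mult_pos_neg)
    moreover obtain z where "z \<in> S" "a \<bullet> z \<le> a \<bullet> ((1 - e) *\<^sub>R y + e *\<^sub>R b)"
      using not_all_inner_greater_if_in_hull [OF e(2)] by blast
    ultimately show "\<exists>y\<in>S. a \<bullet> (b - y) > 0"
      by (intro bexI [of _ z]) (auto simp: inner_diff_right)
  qed
next
  assume strict: ?strict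
  \<comment> \<open>S is nonempty, so a sure loss includes some loss, which by \<open>strict\<close>
    forces a gain.\<close>
  have "\<not> (\<exists>a. \<forall>y\<in>S. a \<bullet> (b - y) < 0)"
    using strict assms(2) by (metis ex_in_conv less_asym)
  then have b: "b \<in> convex hull S"
    by (simp add: in_convex_hull_iff_no_arbitrage assms(1))
  show "b \<in> rel_interior (convex hull S)"
  proof (rule ccontr)
    assume "b \<notin> rel_interior (convex hull S)"
    then have "\<exists>a. (\<forall>y\<in>convex hull S. a \<bullet> b \<le> a \<bullet> y) \<and>
        (\<forall>y\<in>rel_interior (convex hull S). a \<bullet> b < a \<bullet> y)"
      by (rule supporting_hyperplane_rel_boundary [OF convex_convex_hull b]) (intro exI conjI ballI)
    then obtain a where a: "\<forall>y\<in>convex hull S. a \<bullet> b \<le> a \<bullet> y"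
      "\<forall>y\<in>rel_interior (convex hull S). a \<bullet> b < a \<bullet> y"
      by blast
    obtain c where "c \<in> rel_interior (convex hull S)"
      using assms(2) rel_interior_eq_empty [OF convex_convex_hull, of S] by auto
    then have "a \<bullet> b < a \<bullet> c" "c \<in> convex hull S"
      using a(2) rel_interior_subset by blast+
    \<comment> \<open>The point c may lie outside S; using the normal - a yields a point of S that
      loses at least as much.\<close>
    moreover obtain y where "y \<in> S" "- a \<bullet> y \<le> - a \<bullet> c"
      using not_all_inner_greater_if_in_hull \<open>c \<in> convex hull S\<close> by blast
    ultimately have "\<exists>y\<in>S. a \<bullet> (b - y) < 0"
      by (intro bexI [of _ y]) (auto simp: inner_diff_right)
    then obtain z where "z \<in> S" "a \<bullet> (b - z) > 0"
      using strict by blast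
    then show False
      using bspec [OF a(1) hull_inc, of z] by (simp add: inner_diff_right)
  qed
qed

section \<open>Books as points and the polytope of the events\<close>

context
  fixes \<Phi> :: "(real ^ 'n \<Rightarrow> real) set"
    and f :: "'k::finite \<Rightarrow> real ^ 'n \<Rightarrow> real"
  assumes McNaughton: "\<Phi> \<subseteq> McNaughton"
    and bij: "bij_betw f UNIV \<Phi>"
begin

abbreviation event_points :: "(real ^ 'k) set" where
  "event_points \<equiv> (\<lambda>x. \<chi> i. f i x) ` unit_cube"

lemma event_McNaughton: "f i \<in> McNaughton"
  using McNaughton bij by (auto simp: bij_betw_def)

lemma compact_event_points: "compact event_points"
proof (rule compact_continuous_image)
  show "continuous_on unit_cube (\<lambda>x. \<chi> i. f i x)"
    using event_McNaughton by (intro continuous_on_vec_lambda) (simp add: McNaughton_def)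
  show "compact (unit_cube :: (real ^ 'n) set)"
    by (simp add: unit_cube_eq_cbox compact_cbox)
qed

lemma event_points_nonempty: "event_points \<noteq> {}"
proof -
  have "0 \<in> (unit_cube :: (real ^ 'n) set)"
    by (simp add: unit_cube_def)
  then show ?thesis by blast
qed

lemma events_polytope_eq_hull: "events_polytope f = convex hull event_points"
  by (simp add: events_polytope_def closure_closed compact_imp_closed compact_convex_hull
      compact_event_points)

lemma events_polytope_subset: "events_polytope f \<subseteq> unit_cube"
proof -
  have "event_points \<subseteq> unit_cube"
    using event_McNaughton by (fastforce simp: McNaughton_def unit_cube_def PiE_iff)
  then show ?thesis
    unfolding events_polytope_eq_hull unit_cube_eq_cbox by (rule hull_minimal) (rule convex_box)
qed

lemma closed_events_polytope: "closed (events_polytope f)"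
  by (simp add: events_polytope_def)

lemma sum_stakes_eq_inner:
  "(\<Sum>g\<in>\<Phi>. \<sigma> g * (\<beta> g - g x)) = (\<chi> i. \<sigma> (f i)) \<bullet> ((\<chi> i. \<beta> (f i)) - (\<chi> i. f i x))"
  unfolding inner_vec_def by (simp add: sum.reindex_bij_betw [OF bij, symmetric])

text \<open>Stakes are functions on all events, normals are vectors; injectivity of f lets every
  vector be read as stakes through \<open>inv f\<close>.\<close>

lemma all_stakes_iff:
  fixes P :: "real ^ 'k \<Rightarrow> bool"
  shows "(\<forall>\<sigma>. P (\<chi> i. \<sigma> (f i))) \<longleftrightarrow> (\<forall>a. P a)"
proof (intro iffI allI)
  fix a :: "real ^ 'k"
  assume P: "\<forall>\<sigma>. P (\<chi> i. \<sigma> (f i))"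
  have "inv f (f i) = i" for i
    using bij by (simp add: bij_betw_def)
  then have "(\<chi> i. a $ inv f (f i)) = a"
    by simp
  then show "P a"
    using P [rule_format, of "\<lambda>g. a $ inv f g"] by simp
qed simp

lemma coherent_iff_in_polytope:
  "coherent \<Phi> \<beta> \<longleftrightarrow> (\<chi> i. \<beta> (f i)) \<in> events_polytope f"
  unfolding events_polytope_eq_hull in_convex_hull_iff_no_arbitrage [OF compact_event_points]
    coherent_def sum_stakes_eq_inner not_ex ball_simps
  by (rule all_stakes_iff)

lemma strictly_coherent_iff_in_rel_interior:
  "strictly_coherent \<Phi> \<beta> \<longleftrightarrow> (\<chi> i. \<beta> (f i)) \<in> rel_interior (events_polytope f)"
  unfolding events_polytope_eq_hull
    in_rel_interior_hull_iff [OF compact_event_points event_points_nonempty]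
    strictly_coherent_def sum_stakes_eq_inner bex_simps
  by (rule all_stakes_iff)

end

theorem theorem5p5:
  fixes \<Phi> :: "(real ^ 'n \<Rightarrow> real) set"
    and f :: "'k::finite \<Rightarrow> real ^ 'n \<Rightarrow> real"
    and \<beta> :: "(real ^ 'n \<Rightarrow> real) \<Rightarrow> real"
    and Pi_\<Phi> Pi_rb Pi_\<beta> :: "'k luk"
  assumes "\<Phi> \<subseteq> McNaughton"
    and "bij_betw f UNIV \<Phi>"
    and "\<forall>g\<in>\<Phi>. \<beta> g \<in> {0..1} \<inter> \<rat>"
    and "axiomatizes Pi_\<Phi> (Th (events_polytope f))"
    and "axiomatizes Pi_rb (Th (rel_frontier (events_polytope f)))"
    and "axiomatizes Pi_\<beta> (Th {\<chi> i. \<beta> (f i)})"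
  shows "(coherent \<Phi> \<beta> \<longleftrightarrow> (\<exists>m::nat. m \<noteq> 0 \<and> ({} \<turnstile> luk_pow Pi_\<beta> m \<^bold>\<longrightarrow> Pi_\<Phi>))) \<and>
    (strictly_coherent \<Phi> \<beta> \<longleftrightarrow>
       (\<exists>m::nat. m \<noteq> 0 \<and> ({} \<turnstile> luk_pow Pi_\<beta> m \<^bold>\<longrightarrow> Pi_\<Phi>)) \<and>
       (\<forall>m::nat. m \<noteq> 0 \<longrightarrow> \<not> ({} \<turnstile> luk_pow Pi_\<beta> m \<^bold>\<longrightarrow> Pi_rb)))"
proof -
  let ?C = "events_polytope f" and ?b = "\<chi> i. \<beta> (f i)"
  note geometry = assms(1,2)
  have b: "?b \<in> unit_cube"
    using assms(2,3) by (auto simp: unit_cube_def bij_betw_def)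
  \<comment> \<open>The polytope is closed, so its relative interior consists of its points off the
    relative frontier.\<close>
  have frontier: "rel_frontier ?C = ?C - rel_interior ?C"
    by (simp add: rel_frontier_def closed_events_polytope [OF geometry])
  have \<Phi>: "(\<exists>m. m \<noteq> 0 \<and> ({} \<turnstile> luk_pow Pi_\<beta> m \<^bold>\<longrightarrow> Pi_\<Phi>)) \<longleftrightarrow> ?b \<in> ?C"
    using assms b by (intro derives_power_axiom_iff closed_events_polytope events_polytope_subset)
  \<comment> \<open>The frontier is empty if the polytope is a single point; its theory then
    contains all formulas, and the same equivalence applies.\<close>
  have rb_closed: "closed (rel_frontier ?C)"
    by (simp add: events_polytope_eq_hull [OF geometry] closed_rel_frontier)
  have rb: "(\<exists>m. m \<noteq> 0 \<and> ({} \<turnstile> luk_pow Pi_\<beta> m \<^bold>\<longrightarrow> Pi_rb)) \<longleftrightarrow> ?b \<in> rel_frontier ?C"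
    using assms b events_polytope_subset [OF geometry]
    by (intro derives_power_axiom_iff rb_closed) (auto simp: frontier)
  show ?thesis
    using \<Phi> rb frontier rel_interior_subset [of ?C]
      coherent_iff_in_polytope [OF geometry, of \<beta>]
      strictly_coherent_iff_in_rel_interior [OF geometry, of \<beta>]
    by blast
qed

end
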